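(* Let $p\ge2$ and $\mathcal{B}\subset\Sigma_{2\times2}(p)$. Suppose that (i) $\mathbb{H}_2(\mathcal{B})$ is non-degenerated, and (ii) there exists an $H$-primitive commutative cycle pair $(I_qJ_{q'})$ and $(J_{q'}I_q)$ with index $\langle m,\bar\alpha;K,L\rangle$ such that $(S_{m;\bar\alpha,\bar\alpha})_{K,L}=1$ or $(S_{m;\bar\alpha,\bar\alpha})_{L,K}=1$. Then $\mathbb{H}_n(\mathcal{B})$ is primitive for all $n\ge2$.
   Context: Patterns. $\mathcal{S}_p=\{0,\dots,p-1\}$. $\mathbb{Z}_{m\times n}((i,j))=\{(i+n_1,j+n_2):0\le n_1\le m-1,0\le n_2\le n-1\}$, $\mathbb{Z}_{m\times n}=\mathbb{Z}_{m\times n}((0,0))$, $\Sigma_{m\times n}(p)=\mathcal{S}_p^{\mathbb{Z}_{m\times n}}$. Given $\mathcal{B}\subset\Sigma_{2\times2}(p)$, a pattern $U\in\mathcal{S}_p^R$, $R\subset\mathbb{Z}^2$, is $\mathcal{B}$-admissible if $U|_{\mathbb{Z}_{2\times2}((i,j))}\in\mathcal{B}$ (after translation) whenever $\mathbb{Z}_{2\times2}((i,j))\subset R$. Counting function: $\psi(u_1,\dots,u_n)=1+\sum_{k=1}^nu_kp^{n-k}$ for $u_k\in\mathcal{S}_p$. Transition matrices. For $n\ge2$, $\mathbb{H}_n=\mathbb{H}_n(\mathcal{B})$ is the $p^n\times p^n$ zero-one matrix whose $(i,j)$ entry is $1$ iff the pattern $(u_{s,t})_{0\le s\le1,0\le t\le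 n-1}$ on $\mathbb{Z}_{2\times n}$ with $i=\psi(u_{0,0},\dots,u_{0,n-1})$, $j=\psi(u_{1,0},\dots,u_{1,n-1})$ is $\mathcal{B}$-admissible. Write $\mathbb{H}_n$ as a $p\times p$ block matrix $[H_{n;i,j}]_{1\le i,j\le p}$ with blocks of size $p^{n-1}\times p^{n-1}$, and set $H_{n;\alpha}=H_{n;i,j}$ for $\alpha=\psi(i-1,j-1)\in\{1,\dots,p^2\}$. A matrix is non-compressible if it has no zero row and no zero column. $\mathbb{H}_2$ is non-degenerated if $H_{2;\alpha}$ is non-compressible for all $1\le\alpha\le p^2$. A non-negative square matrix $A$ is primitive if there is $N\ge1$ with all entries of $A^n$ positive for all $n\ge N$. Elementary patterns. For $m,n\ge2$, $1\le\alpha\le p^2$, $1\le k\le p^{m-1}$, $H^{(k)}_{m,n;\alpha}=H_{n;j_1,j_2}H_{n;j_2,j_3}\cdots H_{n;j_m,j_{m+1}}$, where $j_1,\dots,j_{m+1}\in\{1,\dots,p\}$ are determined by $\alpha=\psi(j_1-1,j_{m+1}-1)$ and $k=\psi(j_2-1,\dots,j_m-1)$. Connecting operator. For $m\ge2$ and $1\le\alpha,\beta\le p^2$, $S_{m;\alpha,\beta}$ is the $p^{m-1}\times p^{m-1}$ zero-one matrix whose $(s,t)$ entry is $1$ iff the pattern $(u_{a,b})_{0\le a\le m,0\le b\le1}$ on $\mathbb{Z}_{(m+1)\times2}$ with $\alpha=\psi(u_{0,0},u_{m,0})$, $\beta=\psi(u_{0,1},u_{m,1})$, $s=\psi(u_{1,0},\dots,u_{m-1,0})$,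 $t=\psi(u_{1,1},\dots,u_{m-1,1})$ is $\mathcal{B}$-admissible. Commutative cycle pairs. For $q,q'\ge1$ let $I_q=i_1i_2\cdots i_qi_1$ and $J_{q'}=j_1j_2\cdots j_{q'}j_1$ be cycles with entries in $\{1,\dots,p\}$ and $j_1=i_1$. The pair $(I_qJ_{q'})=i_1i_2\cdots i_qi_1j_2\cdots j_{q'}i_1$ and $(J_{q'}I_q)=i_1j_2\cdots j_{q'}i_1i_2\cdots i_qi_1$ is called a commutative cycle pair; its index is $\langle m,\bar\alpha;K,L\rangle$ with $m=q+q'$, $\bar\alpha=\psi(i_1-1,i_1-1)$, $K=\psi(i_2-1,\dots,i_q-1,i_1-1,j_2-1,\dots,j_{q'}-1)$, $L=\psi(j_2-1,\dots,j_{q'}-1,i_1-1,i_2-1,\dots,i_q-1)$. It is an $H$-primitive commutative cycle pair if $H^{(K)}_{m,2;\bar\alpha}$ and $H^{(L)}_{m,2;\bar\alpha}$ are primitive. *)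

theory Defs
  imports "Jordan_Normal_Form.Matrix"
begin

section \<open>Patterns\<close>

definition rect :: "nat \<Rightarrow> nat \<Rightarrow> int \<times> int \<Rightarrow> (int \<times> int) set" where
  "rect m n c = {(fst c + int a, snd c + int b) | a b. a < m \<and> b < n}"

text \<open>A pattern on a region \<open>R\<close> is a function that is \<open>undefined\<close> off \<open>R\<close>,
  so that a set of local patterns is an honest set of functions on the \<open>2 \<times> 2\<close> square.\<close>

definition patterns :: "nat \<Rightarrow> (int \<times> int) set \<Rightarrow> (int \<times> int \<Rightarrow> nat) set" where
  "patterns p R = (R \<rightarrow>\<^sub>E {..<p})"

definition Sigma_pat :: "nat \<Rightarrow> nat \<Rightarrow> nat \<Rightarrow> (int \<times> int \<Rightarrow> nat) set" where
  "Sigma_pat m n p = patterns p (rect m n (0, 0))"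

definition admissible ::
  "(int \<times> int \<Rightarrow> nat) set \<Rightarrow> (int \<times> int) set \<Rightarrow> (int \<times> int \<Rightarrow> nat) \<Rightarrow> bool" where
  "admissible B R U \<longleftrightarrow>
     (\<forall>i j. rect 2 2 (i, j) \<subseteq> R \<longrightarrow>
        restrict (\<lambda>(a, b). U (i + a, j + b)) (rect 2 2 (0, 0)) \<in> B)"

text \<open>The counting function \<open>\<psi>(u\<^sub>1, \<dots>, u\<^sub>n)\<close>; the list is indexed from \<open>0\<close>.\<close>

definition psi :: "nat \<Rightarrow> nat list \<Rightarrow> nat" where
  "psi p us = 1 + (\<Sum>k = 1..length us. us ! (k - 1) * p ^ (length us - k))"


section \<open>Matrices\<close>

text \<open>Rows and columns of type \<open>mat\<close> are numbered from \<open>0\<close>, whereas \<open>\<psi>\<close>, block indices and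
  the indices \<open>\<alpha>\<close>, \<open>k\<close> start at \<open>1\<close>: the mathematical entry \<open>(i, j)\<close> of \<open>A\<close> is
  \<open>A $$ (i - 1, j - 1)\<close>.\<close>

definition non_compressible :: "real mat \<Rightarrow> bool" where
  "non_compressible A \<longleftrightarrow>
     (\<forall>i < dim_row A. row A i \<noteq> 0\<^sub>v (dim_col A)) \<and>
     (\<forall>j < dim_col A. col A j \<noteq> 0\<^sub>v (dim_row A))"

definition primitive_mat :: "real mat \<Rightarrow> bool" where
  "primitive_mat A \<longleftrightarrow>
     square_mat A \<and>
     (\<forall>i < dim_row A. \<forall>j < dim_col A. A $$ (i, j) \<ge> 0) \<and>
     (\<exists>N\<ge>1. \<forall>n\<ge>N. \<forall>i < dim_row A. \<forall>j < dim_col A. (A ^\<^sub>m n) $$ (i, j) > 0)"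

text \<open>In the next definition and in \<open>conn_op\<close> the pattern \<open>U\<close> is determined uniquely by the row
  and column number, since \<open>\<psi>\<close> is injective on words of fixed length over \<open>{0..<p}\<close>
  (\<open>psi_inj\<close> below).\<close>

definition trans_mat :: "nat \<Rightarrow> (int \<times> int \<Rightarrow> nat) set \<Rightarrow> nat \<Rightarrow> real mat" where
  "trans_mat p B n = mat (p ^ n) (p ^ n) (\<lambda>(i, j).
     of_bool (\<exists>U \<in> Sigma_pat 2 n p.
        i + 1 = psi p (map (\<lambda>t. U (0, int t)) [0..<n]) \<and>
        j + 1 = psi p (map (\<lambda>t. U (1, int t)) [0..<n]) \<and>
        admissible B (rect 2 n (0, 0)) U))"

definition trans_block ::
  "nat \<Rightarrow> (int \<times> int \<Rightarrow> nat) set \<Rightarrow> nat \<Rightarrow> nat \<Rightarrow> nat \<Rightarrow> real mat" where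
  "trans_block p B n i j = mat (p ^ (n - 1)) (p ^ (n - 1)) (\<lambda>(a, b).
     trans_mat p B n $$ ((i - 1) * p ^ (n - 1) + a, (j - 1) * p ^ (n - 1) + b))"

definition block_index :: "nat \<Rightarrow> nat \<Rightarrow> nat \<times> nat" where
  "block_index p \<alpha> =
     (THE ij. fst ij \<in> {1..p} \<and> snd ij \<in> {1..p} \<and> \<alpha> = psi p [fst ij - 1, snd ij - 1])"

definition trans_sub ::
  "nat \<Rightarrow> (int \<times> int \<Rightarrow> nat) set \<Rightarrow> nat \<Rightarrow> nat \<Rightarrow> real mat" where
  "trans_sub p B n \<alpha> = trans_block p B n (fst (block_index p \<alpha>)) (snd (block_index p \<alpha>))"

definition non_degenerated :: "nat \<Rightarrow> (int \<times> int \<Rightarrow> nat) set \<Rightarrow> bool" where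
  "non_degenerated p B \<longleftrightarrow> (\<forall>\<alpha> \<in> {1..p ^ 2}. non_compressible (trans_sub p B 2 \<alpha>))"


section \<open>Elementary patterns and connecting operators\<close>

text \<open>For a path \<open>j\<^sub>1 j\<^sub>2 \<dots> j\<^sub>m j\<^bsub>m+1\<^esub>\<close>: the numbers \<open>\<psi>(j\<^sub>1 - 1, j\<^bsub>m+1\<^esub> - 1)\<close> and
  \<open>\<psi>(j\<^sub>2 - 1, \<dots>, j\<^sub>m - 1)\<close>.\<close>

definition path_ends :: "nat \<Rightarrow> nat list \<Rightarrow> nat" where
  "path_ends p js = psi p [hd js - 1, last js - 1]"

definition path_inner :: "nat \<Rightarrow> nat list \<Rightarrow> nat" where
  "path_inner p js = psi p (map (\<lambda>j. j - 1) (butlast (tl js)))"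

definition path_of :: "nat \<Rightarrow> nat \<Rightarrow> nat \<Rightarrow> nat \<Rightarrow> nat list" where
  "path_of p m \<alpha> k =
     (THE js. length js = m + 1 \<and> set js \<subseteq> {1..p} \<and> \<alpha> = path_ends p js \<and> k = path_inner p js)"

definition elem_pattern ::
  "nat \<Rightarrow> (int \<times> int \<Rightarrow> nat) set \<Rightarrow> nat \<Rightarrow> nat \<Rightarrow> nat \<Rightarrow> nat \<Rightarrow> real mat" where
  "elem_pattern p B m n \<alpha> k =
     (let js = path_of p m \<alpha> k
      in foldr (\<lambda>l M. trans_block p B n (js ! l) (js ! (l + 1)) * M) [0..<m] (1\<^sub>m (p ^ (n - 1))))"

definition conn_op ::
  "nat \<Rightarrow> (int \<times> int \<Rightarrow> nat) set \<Rightarrow> nat \<Rightarrow> nat \<Rightarrow> nat \<Rightarrow> real mat" where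
  "conn_op p B m \<alpha> \<beta> = mat (p ^ (m - 1)) (p ^ (m - 1)) (\<lambda>(s, t).
     of_bool (\<exists>U \<in> Sigma_pat (m + 1) 2 p.
        \<alpha> = psi p [U (0, 0), U (int m, 0)] \<and>
        \<beta> = psi p [U (0, 1), U (int m, 1)] \<and>
        s + 1 = psi p (map (\<lambda>a. U (int a, 0)) [1..<m]) \<and>
        t + 1 = psi p (map (\<lambda>a. U (int a, 1)) [1..<m]) \<and>
        admissible B (rect (m + 1) 2 (0, 0)) U))"


section \<open>Commutative cycle pairs\<close>

text \<open>The cycle \<open>i\<^sub>1 i\<^sub>2 \<dots> i\<^sub>q i\<^sub>1\<close> is the list of all its \<open>q + 1\<close> entries, the repeated first entry
  included; entries may otherwise repeat.\<close>

definition is_cycle :: "nat \<Rightarrow> nat \<Rightarrow> nat list \<Rightarrow> bool" where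
  "is_cycle p q I \<longleftrightarrow> q \<ge> 1 \<and> length I = q + 1 \<and> set I \<subseteq> {1..p} \<and> last I = hd I"

definition cycle_prod :: "nat list \<Rightarrow> nat list \<Rightarrow> nat list" where
  "cycle_prod I J = I @ tl J"

definition comm_cycle_pair :: "nat \<Rightarrow> nat \<Rightarrow> nat \<Rightarrow> nat list \<Rightarrow> nat list \<Rightarrow> bool" where
  "comm_cycle_pair p q q' I J \<longleftrightarrow> is_cycle p q I \<and> is_cycle p q' J \<and> hd J = hd I"

text \<open>The index \<open>\<langle>m, \<alpha>; K, L\<rangle>\<close> of the pair \<open>(I J)\<close>, \<open>(J I)\<close>.\<close>

definition pair_index ::
  "nat \<Rightarrow> nat \<Rightarrow> nat \<Rightarrow> nat list \<Rightarrow> nat list \<Rightarrow> nat \<times> nat \<times> nat \<times> nat" where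
  "pair_index p q q' I J =
     (q + q', psi p [hd I - 1, hd I - 1],
      path_inner p (cycle_prod I J), path_inner p (cycle_prod J I))"

definition H_primitive_pair ::
  "nat \<Rightarrow> (int \<times> int \<Rightarrow> nat) set \<Rightarrow> nat \<Rightarrow> nat \<Rightarrow> nat list \<Rightarrow> nat list \<Rightarrow> bool" where
  "H_primitive_pair p B q q' I J \<longleftrightarrow>
     comm_cycle_pair p q q' I J \<and>
     (case pair_index p q q' I J of (m, \<alpha>, K, L) \<Rightarrow>
        primitive_mat (elem_pattern p B m 2 \<alpha> K) \<and>
        primitive_mat (elem_pattern p B m 2 \<alpha> L))"


section \<open>The descriptions above are unique\<close>

lemma psi_Nil [simp]: "psi p [] = 1"
  by (simp add: psi_def)

lemma psi_Cons: "psi p (u # us) = u * p ^ length us + psi p us"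
proof -
  have "(\<Sum>k = 1..length (u # us). (u # us) ! (k - 1) * p ^ (length (u # us) - k))
      = (\<Sum>k = 0..length us. (u # us) ! k * p ^ (length us - k))"
    using sum.shift_bounds_cl_Suc_ivl
      [of "\<lambda>k. (u # us) ! (k - 1) * p ^ (length (u # us) - k)" 0 "length us"] by simp
  also have "\<dots> = u * p ^ length us + (\<Sum>k = 1..length us. (u # us) ! k * p ^ (length us - k))"
    by (simp add: sum.atLeast_Suc_atMost)
  also have "(\<Sum>k = 1..length us. (u # us) ! k * p ^ (length us - k))
      = (\<Sum>k = 1..length us. us ! (k - 1) * p ^ (length us - k))"
    by (rule sum.cong) (auto simp: nth_Cons')
  finally show ?thesis by (simp add: psi_def)
qed

lemma psi_range: "set us \<subseteq> {..<p} \<Longrightarrow> psi p us \<in> {1..p ^ length us}"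
proof (induction us)
  case (Cons u us)
  then have u: "u + 1 \<le> p" and IH: "psi p us \<in> {1..p ^ length us}" by auto
  have "(u + 1) * p ^ length us \<le> p * p ^ length us" using u by (rule mult_right_mono) simp
  with IH show ?case by (simp add: psi_Cons)
qed simp

lemma psi_inj:
  assumes "length us = length vs" "set us \<subseteq> {..<p}" "set vs \<subseteq> {..<p}" "psi p us = psi p vs"
  shows "us = vs"
  using assms
proof (induction us vs rule: list_induct2)
  case (Cons u us v vs)
  let ?q = "p ^ length us"
  obtain a b where a: "psi p us = Suc a" "a < ?q" and b: "psi p vs = Suc b" "b < ?q"
    using psi_range[of us p] psi_range[of vs p] Cons.prems Cons.hyps
    by (cases "psi p us"; cases "psi p vs") auto
  have eq: "u * ?q + a = v * ?q + b"
    using Cons.prems a b Cons.hyps by (simp add: psi_Cons)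
  have "?q \<noteq> 0" using a(2) by linarith
  then have "(u * ?q + a) div ?q = u" "(v * ?q + b) div ?q = v" using a b by simp_all
  with eq have "u = v" by simp
  with eq a b Cons show ?case by simp
qed simp

lemma psi_bij: "bij_betw (psi p) {us. length us = n \<and> set us \<subseteq> {..<p}} {1..p ^ n}"
proof -
  let ?W = "{us. set us \<subseteq> {..<p} \<and> length us = n}"
  have inj: "inj_on (psi p) ?W" by (auto intro!: inj_onI psi_inj)
  have "psi p ` ?W \<subseteq> {1..p ^ n}" by (auto dest!: psi_range)
  moreover have "card (psi p ` ?W) = card {1..p ^ n}"
    using card_lists_length_eq[of "{..<p}" n] by (simp add: card_image[OF inj])
  ultimately have "psi p ` ?W = {1..p ^ n}" by (intro card_subset_eq) auto
  with inj show ?thesis by (simp add: bij_betw_def conj_commute)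
qed

lemma block_index_psi:
  assumes "i \<in> {1..p}" "j \<in> {1..p}"
  shows "block_index p (psi p [i - 1, j - 1]) = (i, j)"
  unfolding block_index_def
proof (rule the_equality)
  fix ij assume *: "fst ij \<in> {1..p} \<and> snd ij \<in> {1..p} \<and>
    psi p [i - 1, j - 1] = psi p [fst ij - 1, snd ij - 1]"
  then have "[i - 1, j - 1] = [fst ij - 1, snd ij - 1]"
    by (intro psi_inj[of _ _ p]) (use assms in auto)
  with * assms show "ij = (i, j)" by (cases ij) auto
qed (use assms in auto)

lemma path_of_eq:
  assumes js: "length js = m + 1" "set js \<subseteq> {1..p}" and m: "m \<ge> 1"
  shows "path_of p m (path_ends p js) (path_inner p js) = js"
  unfolding path_of_def
proof (rule the_equality)
  have split: "xs = hd xs # butlast (tl xs) @ [last xs]" if "length xs = m + 1" for xs :: "nat list"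
    using that m by (cases xs; cases "tl xs") auto
  have ends: "hd xs \<in> {1..p} \<and> last xs \<in> {1..p} \<and> set (butlast (tl xs)) \<subseteq> {1..p}"
    if "length xs = m + 1" "set xs \<subseteq> {1..p}" for xs
    using that(2) by (subst (asm) split[OF that(1)]) auto
  fix js' assume *: "length js' = m + 1 \<and> set js' \<subseteq> {1..p} \<and>
    path_ends p js = path_ends p js' \<and> path_inner p js = path_inner p js'"
  note e = ends[OF js] and e' = ends[of js']
  have "[hd js - 1, last js - 1] = [hd js' - 1, last js' - 1]"
    by (rule psi_inj[of _ _ p]) (use * e e' in \<open>auto simp: path_ends_def\<close>)
  then have 1: "hd js = hd js'" "last js = last js'" using * e e' by auto
  have "map (\<lambda>j. j - 1) (butlast (tl js)) = map (\<lambda>j. j - 1) (butlast (tl js'))"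
    by (rule psi_inj[of _ _ p]) (use * e e' js in \<open>force simp: path_inner_def\<close>)+
  then have "butlast (tl js) = butlast (tl js')"
  proof (rule map_inj_on)
    have "inj_on (\<lambda>j::nat. j - 1) {1..p}" by (auto intro!: inj_onI)
    then show "inj_on (\<lambda>j. j - 1) (set (butlast (tl js)) \<union> set (butlast (tl js')))"
      by (rule inj_on_subset) (use * e e' in auto)
  qed
  with 1 split[OF js(1)] split[of js'] * show "js' = js" by metis
qed (use js in auto)

end

theory Submission imports Defs begin

text \<open>If \<open>(J I)\<close> may sit on top of \<open>(I J)\<close>, let \<open>w\<close> be the bi-infinite \<open>m\<close>-periodic word
  spelled by \<open>(I J)\<close>. Then \<open>(J I)\<close> spells \<open>w\<close> shifted by \<open>q\<close>, so \<open>w(x + q)\<close> may be put on top of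
  \<open>w(x)\<close>, and hence the rows \<open>w(x + t q)\<close>, \<open>t = 0, 1, \<dots>\<close>, stack up to any height. Any column can be
  steered into this staircase from the bottom row up: the bottom row is unconstrained; once the
  first \<open>t\<close> rows follow the staircase, primitivity of the elementary pattern of \<open>(I J)\<close> leads row
  \<open>t + 1\<close> from any symbol to the right one, and non-degeneracy extends the rows above meanwhile.
  The waiting time in the bottom row is free, so all large lengths occur. Reflection in the
  vertical axis shows that any column can be reached from the staircase as well.\<close>

section \<open>Positive entries of products of non-negative matrices\<close>

text \<open>Carries walks along a map of graphs: it translates and reflects runs of a row, lifts
  them to columns, and passes from columns to matrix indices.\<close>

lemma relpowp_map:
  assumes "\<And>x y. P x y \<Longrightarrow> R (f x) (f y)" and "(P ^^ k) x y"
  shows "(R ^^ k) (f x) (f y)"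
  using assms(2)
proof (induction k arbitrary: y)
  case (Suc k)
  then obtain z where "(P ^^ k) x z" "P z y" by auto
  with Suc.IH assms(1) show ?case by auto
qed simp

lemma relpowp_conversep:
  fixes R :: "'a \<Rightarrow> 'a \<Rightarrow> bool"
  shows "((R\<inverse>\<inverse>) ^^ k) x y \<longleftrightarrow> (R ^^ k) y x"
proof (induction k arbitrary: y)
  case (Suc k)
  have "((R\<inverse>\<inverse>) ^^ Suc k) x y \<longleftrightarrow> (\<exists>z. R y z \<and> (R ^^ k) z x)"
    by (auto simp: Suc.IH)
  then show ?case by (metis relpowp_Suc_D2 relpowp_Suc_I2)
qed auto

definition nonneg_mat :: "nat \<Rightarrow> real mat \<Rightarrow> bool" where
  "nonneg_mat n A \<longleftrightarrow> A \<in> carrier_mat n n \<and> (\<forall>i<n. \<forall>j<n. A $$ (i, j) \<ge> 0)"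

lemma mult_mat_entry:
  assumes "A \<in> carrier_mat n n" "M \<in> carrier_mat n n" "i < n" "j < n"
  shows "(A * M) $$ (i, j) = (\<Sum>k\<in>{0..<n}. A $$ (i, k) * M $$ (k, j))"
  using assms by (auto simp: scalar_prod_def intro!: sum.cong)

lemma nonneg_mat_one: "nonneg_mat n (1\<^sub>m n)"
  by (auto simp: nonneg_mat_def)

lemma nonneg_mat_mult:
  assumes "nonneg_mat n A" "nonneg_mat n M"
  shows "nonneg_mat n (A * M)"
  using assms by (auto simp: nonneg_mat_def mult_mat_entry[of _ n] simp del: index_mult_mat(1)
    intro!: sum_nonneg)

text \<open>Non-negative summands cannot cancel, so supports multiply like relations.\<close>

lemma mult_mat_pos_iff:
  assumes A: "nonneg_mat n A" and M: "nonneg_mat n M" and "i < n" "j < n"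
  shows "(A * M) $$ (i, j) > 0 \<longleftrightarrow> (\<exists>k<n. A $$ (i, k) > 0 \<and> M $$ (k, j) > 0)"
proof -
  have nn: "A $$ (i, k) \<ge> 0" "M $$ (k, j) \<ge> 0" if "k < n" for k
    using assms that by (auto simp: nonneg_mat_def)
  have "(A * M) $$ (i, j) = (\<Sum>k\<in>{0..<n}. A $$ (i, k) * M $$ (k, j))"
    using assms by (intro mult_mat_entry) (auto simp: nonneg_mat_def)
  also have "\<dots> > 0 \<longleftrightarrow> (\<exists>k\<in>{0..<n}. A $$ (i, k) * M $$ (k, j) > 0)"
  proof
    assume pos: "(\<Sum>k\<in>{0..<n}. A $$ (i, k) * M $$ (k, j)) > 0"
    show "\<exists>k\<in>{0..<n}. A $$ (i, k) * M $$ (k, j) > 0"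
    proof (rule ccontr)
      assume "\<not> ?thesis"
      then have "(\<Sum>k\<in>{0..<n}. A $$ (i, k) * M $$ (k, j)) \<le> 0"
        by (intro sum_nonpos) (auto simp: not_less)
      with pos show False by simp
    qed
  next
    assume "\<exists>k\<in>{0..<n}. A $$ (i, k) * M $$ (k, j) > 0"
    then obtain k where "k \<in> {0..<n}" "A $$ (i, k) * M $$ (k, j) > 0" by blast
    then show "(\<Sum>k\<in>{0..<n}. A $$ (i, k) * M $$ (k, j)) > 0"
      using nn by (intro sum_pos2[of _ k]) auto
  qed
  also have "\<dots> \<longleftrightarrow> (\<exists>k<n. A $$ (i, k) > 0 \<and> M $$ (k, j) > 0)"
    using nn by (force simp: zero_less_mult_iff)
  finally show ?thesis .
qed

lemma nonneg_mat_pow: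
  assumes "nonneg_mat n A"
  shows "nonneg_mat n (A ^\<^sub>m l)"
proof (induction l)
  case 0
  have "dim_row A = n" using assms by (auto simp: nonneg_mat_def)
  then show ?case by (simp add: nonneg_mat_one)
qed (simp add: nonneg_mat_mult assms)

text \<open>Turns positivity of powers into existence of walks, the form in which the dynamical part
  is argued.\<close>

lemma pow_mat_pos_iff:
  assumes A: "nonneg_mat n A" and "i < n" "j < n"
  shows "(A ^\<^sub>m l) $$ (i, j) > 0 \<longleftrightarrow>
    ((\<lambda>i j. i < n \<and> j < n \<and> A $$ (i, j) > 0) ^^ l) i j"
  using \<open>j < n\<close>
proof (induction l arbitrary: j)
  case 0
  have "dim_row A = n" using A by (auto simp: nonneg_mat_def)
  with 0 \<open>i < n\<close> show ?case by simp
next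
  case (Suc l)
  show ?case
    unfolding pow_mat.simps mult_mat_pos_iff[OF nonneg_mat_pow[OF A] A \<open>i < n\<close> Suc.prems]
    using Suc by (auto simp: relcompp.simps)
qed

section \<open>Columns and the staircase pattern\<close>

text \<open>\<open>b i a j c\<close> means that the \<open>2 \<times> 2\<close> square with bottom row \<open>i j\<close> and top row \<open>a c\<close> is
  allowed; columns are lists read from the bottom.\<close>

definition columns :: "nat \<Rightarrow> nat \<Rightarrow> nat list set" where
  "columns p n = {xs. length xs = n \<and> set xs \<subseteq> {..<p}}"

definition col_step ::
  "nat \<Rightarrow> (nat \<Rightarrow> nat \<Rightarrow> nat \<Rightarrow> nat \<Rightarrow> bool) \<Rightarrow> nat \<Rightarrow> nat list \<Rightarrow> nat list \<Rightarrow> bool" where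
  "col_step p b n xs ys \<longleftrightarrow> xs \<in> columns p n \<and> ys \<in> columns p n \<and>
     (\<forall>t. Suc t < n \<longrightarrow> b (xs ! t) (xs ! Suc t) (ys ! t) (ys ! Suc t))"

text \<open>One step of a row running on top of the word \<open>w\<close>; the state records the position.\<close>

definition row_step ::
  "nat \<Rightarrow> (nat \<Rightarrow> nat \<Rightarrow> nat \<Rightarrow> nat \<Rightarrow> bool) \<Rightarrow> (int \<Rightarrow> nat) \<Rightarrow> int \<times> nat \<Rightarrow> int \<times> nat \<Rightarrow> bool" where
  "row_step p b w = (\<lambda>(s, a) (s', c). s' = s + 1 \<and> a < p \<and> c < p \<and> b (w s) a (w s') c)"

lemma col_step_snoc:
  assumes "col_step p b (Suc n) xs ys" "a < p" "c < p" "b (xs ! n) a (ys ! n) c"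
  shows "col_step p b (Suc (Suc n)) (xs @ [a]) (ys @ [c])"
  using assms by (auto simp: col_step_def columns_def nth_append less_Suc_eq)

text \<open>What the argument asks of the local patterns: \<open>ext_right\<close> and
  \<open>ext_left\<close> will come from non-degeneracy, \<open>stack\<close> from the entry of the
  connecting operator, \<open>mixing\<close> from primitivity. Mixing in one length \<open>M\<close>
  from position 0 suffices, because the waiting time is gained in the bottom row;
  \<open>m_dvd\<close> brings the word back to its phase after \<open>M\<close> steps.\<close>

locale staircase =
  fixes p :: nat and b :: "nat \<Rightarrow> nat \<Rightarrow> nat \<Rightarrow> nat \<Rightarrow> bool"
    and w :: "int \<Rightarrow> nat" and q :: int and m :: nat and M :: nat
  assumes m_pos: "m > 0"
    and w_less: "w x < p"
    and w_per: "w (x + int m) = w x"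
    and ext_right: "\<lbrakk>i < p; j < p; a < p\<rbrakk> \<Longrightarrow> \<exists>c<p. b i a j c"
    and ext_left: "\<lbrakk>i < p; j < p; c < p\<rbrakk> \<Longrightarrow> \<exists>a<p. b i a j c"
    and stack: "b (w x) (w (x + q)) (w (x + 1)) (w (x + 1 + q))"
    and m_dvd: "m dvd M"
    and mixing: "\<lbrakk>a < p; c < p\<rbrakk> \<Longrightarrow> (row_step p b w ^^ M) (0, a) (int M, c)"
begin

section \<open>Columns of the staircase and their periodicity\<close>

lemma w_per_int: "w (x + int m * k) = w x"
proof (induction k rule: int_induct[of _ 0])
  case (step1 i)
  then show ?case using w_per[of "x + int m * i"] by (simp add: algebra_simps)
next
  case (step2 i)
  then show ?case using w_per[of "x + int m * (i - 1)"] by (simp add: algebra_simps)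
qed simp

definition C :: "nat \<Rightarrow> int \<Rightarrow> nat list" where
  "C n s = map (\<lambda>t. w (s + int t * q)) [0..<n]"

lemma C_columns: "C n s \<in> columns p n"
  by (auto simp: C_def columns_def w_less)

lemma C_Suc: "C (Suc n) s = C n s @ [w (s + int n * q)]"
  by (simp add: C_def)

lemma C_shift: "C n (s + int m * k) = C n s"
  using w_per_int[of "s + int t * q" k for t] by (simp add: C_def algebra_simps)

lemma C_step: "col_step p b n (C n s) (C n (s + 1))"
  using stack[of "s + int t * q" for t]
  by (auto simp: col_step_def C_columns) (auto simp: C_def algebra_simps)

lemma C_steps: "(col_step p b n ^^ k) (C n s) (C n (s + int k))"
proof (induction k)
  case (Suc k)
  then show ?case using C_step[of n "s + int k"] by (auto simp: algebra_simps)
qed simp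

section \<open>Steering a column into the staircase\<close>

text \<open>Squares are completed from left to right: three corners are known and
  \<open>ext_right\<close> supplies the fourth. The final symbol \<open>c\<close> is not under
  control; \<open>enter_top\<close> corrects it.\<close>

lemma top_extension:
  assumes "(col_step p b (Suc n) ^^ k) xs ys" "a < p"
  shows "\<exists>c<p. (col_step p b (Suc (Suc n)) ^^ k) (xs @ [a]) (ys @ [c])"
  using assms(1)
proof (induction k arbitrary: ys)
  case 0
  then show ?case using assms(2) by auto
next
  case (Suc k)
  then obtain zs where zs: "(col_step p b (Suc n) ^^ k) xs zs" "col_step p b (Suc n) zs ys"
    by auto
  with Suc.IH obtain d where d: "d < p"
    "(col_step p b (Suc (Suc n)) ^^ k) (xs @ [a]) (zs @ [d])" by blast
  have "zs ! n < p" "ys ! n < p"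
    using zs(2) nth_mem[of n zs] nth_mem[of n ys]
    by (auto simp: col_step_def columns_def simp del: nth_mem)
  then obtain c where c: "c < p" "b (zs ! n) d (ys ! n) c" using ext_right d(1) by blast
  with col_step_snoc[OF zs(2) d(1)] d(2) show ?case by auto
qed

text \<open>The lower \<open>Suc n\<close> rows follow the staircase while the row above them moves
  from \<open>a\<close> to \<open>c\<close>. With this \<open>s\<close>, row \<open>n\<close>,
  directly below the moving one, reads \<open>w\<close> from position 0, where \<open>mixing\<close>
  applies.\<close>

lemma enter_top:
  assumes "a < p" "c < p" and s: "s = - int n * q"
  shows "(col_step p b (Suc (Suc n)) ^^ M) (C (Suc n) s @ [a]) (C (Suc n) s @ [c])"
proof -
  \<comment> \<open>A state of the moving row becomes a column: position \<open>x\<close> of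
    \<open>w\<close> in row \<open>n\<close> is position \<open>x - int n * q\<close> in row
    0.\<close>
  let ?f = "\<lambda>(x, a). C (Suc n) (x - int n * q) @ [a]"
  have "col_step p b (Suc (Suc n)) (?f y) (?f z)" if "row_step p b w y z" for y z
  proof -
    obtain x a x' c where yz: "y = (x, a)" "z = (x', c)" by (cases y, cases z) auto
    have "col_step p b (Suc n) (C (Suc n) (x - int n * q)) (C (Suc n) (x' - int n * q))"
      using that C_step[of "Suc n" "x - int n * q"] by (simp add: yz row_step_def algebra_simps)
    then show ?thesis using that unfolding yz prod.case
      by (intro col_step_snoc) (auto simp: yz row_step_def C_def nth_append)
  qed
  then have "(col_step p b (Suc (Suc n)) ^^ M) (?f (0, a)) (?f (int M, c))"
    using mixing[OF assms(1,2)] by (rule relpowp_map)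
  then have "(col_step p b (Suc (Suc n)) ^^ M) (C (Suc n) s @ [a]) (C (Suc n) (int M + s) @ [c])"
    by (simp add: s)
  moreover have "C (Suc n) (int M + s) = C (Suc n) s"
    using m_dvd C_shift[of "Suc n" s] by (auto simp: dvd_def add.commute)
  ultimately show ?thesis by simp
qed

text \<open>The phase \<open>s\<close> is kept arbitrary in the induction on the height, since the
  hypothesis is applied at the phase that \<open>enter_top\<close> requires.\<close>

lemma reach_staircase:
  "\<exists>T. \<forall>l\<ge>T. \<forall>xs\<in>columns p (Suc n). (col_step p b (Suc n) ^^ l) xs (C (Suc n) s)"
proof (induction n arbitrary: s)
  case 0
  \<comment> \<open>A column of height one contains no square, so any two are joined by a single
    step, and hence by any positive number of steps.\<close>
  have st: "col_step p b (Suc 0) xs ys" if "xs \<in> columns p (Suc 0)" "ys \<in> columns p (Suc 0)" for xs ys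
    using that by (simp add: col_step_def)
  have "(col_step p b (Suc 0) ^^ Suc l) xs ys"
    if "xs \<in> columns p (Suc 0)" "ys \<in> columns p (Suc 0)" for l xs ys
    using that(2)
  proof (induction l arbitrary: ys)
    case (Suc l)
    with st[OF Suc.prems Suc.prems] show ?case by (meson relpowp_Suc_I)
  qed (use st that in auto)
  then have "\<forall>l\<ge>1. \<forall>xs\<in>columns p (Suc 0). (col_step p b (Suc 0) ^^ l) xs (C (Suc 0) s)"
    using C_columns by (metis Suc_le_D One_nat_def)
  then show ?case by blast
next
  case (Suc n)
  \<comment> \<open>\<open>s0\<close> is the phase at which the top row can enter; \<open>k\<close>
    further steps along the staircase lead from there to phase \<open>s\<close> modulo
    \<open>m\<close>.\<close>
  define s0 where "s0 = - int n * q"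
  define k where "k = nat ((s - s0) mod int m)"
  let ?R = "col_step p b (Suc (Suc n))"
  have "int k = s - s0 - int m * ((s - s0) div int m)"
    using m_pos by (simp add: k_def minus_mult_div_eq_mod)
  then have k: "s0 + int k = s + int m * (- ((s - s0) div int m))" by simp
  from Suc obtain T where
    T: "\<And>l xs. \<lbrakk>l \<ge> T; xs \<in> columns p (Suc n)\<rbrakk> \<Longrightarrow> (col_step p b (Suc n) ^^ l) xs (C (Suc n) s0)"
    by blast
  have "(?R ^^ l) xs (C (Suc (Suc n)) s)" if l: "l \<ge> T + M + k" and xs: "xs \<in> columns p (Suc (Suc n))"
    for l xs
  proof -
    obtain ys a where ys: "xs = ys @ [a]" using xs by (cases xs rule: rev_cases) (auto simp: columns_def)
    with xs have ys': "ys \<in> columns p (Suc n)" "a < p" by (auto simp: columns_def)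
    \<comment> \<open>Three stages: \<open>l - M - k\<close> steps bring the lower rows to the
      staircase, \<open>M\<close> steps let the top row join, \<open>k\<close> steps adjust the
      phase. All slack lies in the first stage.\<close>
    from l have "l - M - k \<ge> T" by simp
    from top_extension[OF T[OF this ys'(1)] ys'(2)] obtain c where
      c: "c < p" "(?R ^^ (l - M - k)) xs (C (Suc n) s0 @ [c])" by (auto simp: ys)
    have "(?R ^^ M) (C (Suc n) s0 @ [c]) (C (Suc (Suc n)) s0)"
      using enter_top[OF c(1) w_less s0_def] by (simp add: C_Suc[of "Suc n"])
    with c(2) have "(?R ^^ (l - M - k + M)) xs (C (Suc (Suc n)) s0)"
      unfolding relpowp_add by blast
    moreover have "(?R ^^ k) (C (Suc (Suc n)) s0) (C (Suc (Suc n)) s)"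
      using C_steps[where n = "Suc (Suc n)" and k = k and s = s0] unfolding k C_shift .
    ultimately have "(?R ^^ (l - M - k + M + k)) xs (C (Suc (Suc n)) s)"
      by (subst relpowp_add) blast
    then show ?thesis using l by simp
  qed
  then show ?case by blast
qed

end

section \<open>Reflection, and mixing of columns\<close>

text \<open>Reflection exchanges the two columns of a square, hence \<open>ext_right\<close> and
  \<open>ext_left\<close>; the word is read backwards and the shift changes sign.\<close>

lemma (in staircase) reflect:
  "staircase p (\<lambda>i a j c. b j c i a) (\<lambda>x. w (- x)) (- q) m M"
proof
  show "w (- (x + int m)) = w (- x)" for x
    using w_per[of "- x - int m"] by simp
  show "\<lbrakk>i < p; j < p; a < p\<rbrakk> \<Longrightarrow> \<exists>c<p. b j c i a" for i j a
    using ext_left by blast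
  show "\<lbrakk>i < p; j < p; c < p\<rbrakk> \<Longrightarrow> \<exists>a<p. b j c i a" for i j c
    using ext_right by blast
  show "b (w (- (x + 1))) (w (- (x + 1 + - q))) (w (- x)) (w (- (x + - q)))" for x
  proof -
    \<comment> \<open>The reflected square at \<open>x\<close> is the original one with left column
      at \<open>- x - 1\<close>.\<close>
    define y where "y = - x - 1"
    have "- (x + 1) = y" "- (x + 1 + - q) = y + q" "- x = y + 1" "- (x + - q) = y + 1 + q"
      by (simp_all add: y_def)
    then show ?thesis using stack[of y] by (simp only:)
  qed
  fix a c assume ac: "a < p" "c < p"
  let ?Q = "row_step p (\<lambda>i a j c. b j c i a) (\<lambda>x. w (- x))"
  \<comment> \<open>A reversed run must again start at position 0, hence \<open>int M - x\<close>
    instead of \<open>- x\<close>; the translation by \<open>M\<close> is invisible to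
    \<open>w\<close> because \<open>m\<close> divides \<open>M\<close>.\<close>
  let ?f = "\<lambda>(x, a::nat). (int M - x, a)"
  obtain d where d: "M = m * d" using m_dvd by blast
  have w: "w (x - int M) = w x" for x
    using w_per_int[of "x" "- int d"] by (simp add: d)
  have "(row_step p b w ^^ M) (0, c) (int M, a)" using mixing ac by blast
  then have "(?Q\<inverse>\<inverse> ^^ M) (?f (0, c)) (?f (int M, a))"
    by (rule relpowp_map[rotated]) (auto simp: row_step_def w)
  then show "(?Q ^^ M) (0, a) (int M, c)"
    by (simp add: relpowp_conversep)
qed (use m_pos w_less m_dvd in auto)

text \<open>Walks under the reflected rule are reversed walks, and the reflected staircase at phase
  \<open>- s\<close> is the same column.\<close>

lemma (in staircase) leave_staircase:
  "\<exists>T. \<forall>l\<ge>T. \<forall>ys\<in>columns p (Suc n). (col_step p b (Suc n) ^^ l) (C (Suc n) s) ys"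
proof -
  interpret r: staircase p "\<lambda>i a j c. b j c i a" "\<lambda>x. w (- x)" "- q" m M
    by (rule reflect)
  have "r.C (Suc n) (- s) = C (Suc n) s"
    by (simp add: r.C_def C_def algebra_simps)
  moreover have "col_step p (\<lambda>i a j c. b j c i a) (Suc n) = (col_step p b (Suc n))\<inverse>\<inverse>"
    by (auto simp: col_step_def fun_eq_iff)
  ultimately show ?thesis
    using r.reach_staircase[of n "- s"] by (simp add: relpowp_conversep)
qed

text \<open>All walks pass through \<open>C (Suc n) 0\<close>: the exit takes the fixed time
  \<open>T2\<close>, and the way in absorbs the remaining length.\<close>

lemma (in staircase) col_step_mixing:
  "\<exists>T\<ge>1. \<forall>l\<ge>T. \<forall>xs\<in>columns p (Suc n). \<forall>ys\<in>columns p (Suc n). (col_step p b (Suc n) ^^ l) xs ys"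
proof -
  obtain T1 where T1: "\<And>l xs. \<lbrakk>l \<ge> T1; xs \<in> columns p (Suc n)\<rbrakk> \<Longrightarrow>
    (col_step p b (Suc n) ^^ l) xs (C (Suc n) 0)"
    using reach_staircase[of n 0] by blast
  obtain T2 where T2: "\<And>ys. ys \<in> columns p (Suc n) \<Longrightarrow>
    (col_step p b (Suc n) ^^ T2) (C (Suc n) 0) ys"
    using leave_staircase[of n 0] by blast
  have "(col_step p b (Suc n) ^^ l) xs ys"
    if "l \<ge> T1 + T2 + 1" "xs \<in> columns p (Suc n)" "ys \<in> columns p (Suc n)" for l xs ys
  proof -
    have "(col_step p b (Suc n) ^^ (l - T2 + T2)) xs ys"
      using T1[of "l - T2" xs] T2[of ys] that unfolding relpowp_add by (intro relcomppI) auto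
    then show ?thesis using that by simp
  qed
  then show ?thesis by (intro exI[of _ "T1 + T2 + 1"]) auto
qed

section \<open>Transition matrices and elementary patterns\<close>

text \<open>Corners are listed column by column, each from the bottom. The restriction makes the
  function \<open>undefined\<close> off the square, as for the patterns in \<open>B\<close>.\<close>

definition allowed ::
  "(int \<times> int \<Rightarrow> nat) set \<Rightarrow> nat \<Rightarrow> nat \<Rightarrow> nat \<Rightarrow> nat \<Rightarrow> bool" where
  "allowed B i a j c \<longleftrightarrow>
     restrict (\<lambda>(x, y). if x = 0 then if y = 0 then i else a else if y = 0 then j else c)
       (rect 2 2 (0, 0)) \<in> B"

lemma rect_iff: "(x, y) \<in> rect m n (i, j) \<longleftrightarrow> i \<le> x \<and> x < i + int m \<and> j \<le> y \<and> y < j + int n"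
proof
  assume "i \<le> x \<and> x < i + int m \<and> j \<le> y \<and> y < j + int n"
  then show "(x, y) \<in> rect m n (i, j)"
    unfolding rect_def by (intro CollectI exI[of _ "nat (x - i)"] exI[of _ "nat (y - j)"]) auto
qed (auto simp: rect_def)

lemma rect2_subset_iff:
  "rect 2 2 (i, j) \<subseteq> rect m n (0, 0) \<longleftrightarrow> 0 \<le> i \<and> i + 1 < int m \<and> 0 \<le> j \<and> j + 1 < int n"
proof
  assume *: "rect 2 2 (i, j) \<subseteq> rect m n (0, 0)"
  have "(i, j) \<in> rect 2 2 (i, j)" "(i + 1, j + 1) \<in> rect 2 2 (i, j)" by (simp_all add: rect_iff)
  with * have "(i, j) \<in> rect m n (0, 0)" "(i + 1, j + 1) \<in> rect m n (0, 0)" by blast+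
  then show "0 \<le> i \<and> i + 1 < int m \<and> 0 \<le> j \<and> j + 1 < int n" by (simp add: rect_iff)
qed (auto simp: rect_iff)

lemma admissible_iff:
  "admissible B (rect m n (0, 0)) U \<longleftrightarrow>
    (\<forall>i j. Suc i < m \<and> Suc j < n \<longrightarrow>
      allowed B (U (int i, int j)) (U (int i, int j + 1)) (U (int i + 1, int j)) (U (int i + 1, int j + 1)))"
proof -
  have eq: "restrict (\<lambda>(a, b). U (i + a, j + b)) (rect 2 2 (0, 0)) \<in> B \<longleftrightarrow>
    allowed B (U (i, j)) (U (i, j + 1)) (U (i + 1, j)) (U (i + 1, j + 1))" for i j
  proof -
    have "x = 0 \<or> x = 1" "y = 0 \<or> y = 1" if "(x, y) \<in> rect 2 2 (0, 0)" for x y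
      using that by (auto simp: rect_iff)
    then show ?thesis unfolding allowed_def
      by (intro arg_cong[of _ _ "\<lambda>f. f \<in> B"] restrict_ext) fastforce
  qed
  have "admissible B (rect m n (0, 0)) U \<longleftrightarrow>
    (\<forall>i j. 0 \<le> i \<and> i + 1 < int m \<and> 0 \<le> j \<and> j + 1 < int n \<longrightarrow>
      allowed B (U (i, j)) (U (i, j + 1)) (U (i + 1, j)) (U (i + 1, j + 1)))"
    unfolding admissible_def eq rect2_subset_iff ..
  also have "\<dots> \<longleftrightarrow> (\<forall>i j. Suc i < m \<and> Suc j < n \<longrightarrow>
      allowed B (U (int i, int j)) (U (int i, int j + 1)) (U (int i + 1, int j)) (U (int i + 1, int j + 1)))"
    (is "?L \<longleftrightarrow> ?R")
  proof
    assume ?L then show ?R by simp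
  next
    assume R: ?R
    show ?L
    proof (intro allI impI)
      fix i j assume "0 \<le> i \<and> i + 1 < int m \<and> 0 \<le> j \<and> j + 1 < int n"
      moreover from this have "Suc (nat i) < m" "Suc (nat j) < n" by linarith+
      ultimately show "allowed B (U (i, j)) (U (i, j + 1)) (U (i + 1, j)) (U (i + 1, j + 1))"
        using R[rule_format, of "nat i" "nat j"] by auto
    qed
  qed
  finally show ?thesis .
qed

lemma psi_minus_less: "xs \<in> columns p n \<Longrightarrow> psi p xs - 1 < p ^ n"
  using psi_range[of xs p] by (force simp: columns_def)

text \<open>Injectivity of \<open>psi\<close> recovers both columns of the pattern from the index
  pair; the subtraction of 1 passes from \<open>psi\<close>, which starts at 1, to matrix indices,
  which start at 0.\<close>

lemma trans_mat_entry:
  assumes xs: "xs \<in> columns p n" and ys: "ys \<in> columns p n"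
  shows "trans_mat p B n $$ (psi p xs - 1, psi p ys - 1) = of_bool (col_step p (allowed B) n xs ys)"
proof -
  have psi: "psi p xs - 1 + 1 = psi p xs" "psi p ys - 1 + 1 = psi p ys"
    using psi_range[of xs p] psi_range[of ys p] xs ys by (auto simp: columns_def)
  have "(\<exists>U \<in> Sigma_pat 2 n p.
        psi p xs - 1 + 1 = psi p (map (\<lambda>t. U (0, int t)) [0..<n]) \<and>
        psi p ys - 1 + 1 = psi p (map (\<lambda>t. U (1, int t)) [0..<n]) \<and>
        admissible B (rect 2 n (0, 0)) U) \<longleftrightarrow> col_step p (allowed B) n xs ys" (is "?L \<longleftrightarrow> ?R")
  proof
    assume ?L
    then obtain U where U: "U \<in> Sigma_pat 2 n p"
      "psi p xs = psi p (map (\<lambda>t. U (0, int t)) [0..<n])"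
      "psi p ys = psi p (map (\<lambda>t. U (1, int t)) [0..<n])"
      "admissible B (rect 2 n (0, 0)) U" unfolding psi by blast
    have "U (0, int t) < p" "U (1, int t) < p" if "t < n" for t
      using U(1) that by (auto simp: Sigma_pat_def patterns_def rect_iff PiE_iff)
    then have "xs = map (\<lambda>t. U (0, int t)) [0..<n]" "ys = map (\<lambda>t. U (1, int t)) [0..<n]"
      using U(2,3) xs ys by (auto intro!: psi_inj[of _ _ p] simp: columns_def)
    with U(4) xs ys show ?R by (auto simp: admissible_iff col_step_def less_Suc_eq add.commute)
  next
    assume R: ?R
    define U where "U = restrict (\<lambda>(x, y). (if x = 0 then xs else ys) ! nat y) (rect 2 n (0, 0))"
    have U: "U (0, int t) = xs ! t" "U (1, int t) = ys ! t" if "t < n" for t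
      using that by (auto simp: U_def rect_iff)
    have "xs ! t < p" "ys ! t < p" if "t < n" for t
      using xs ys that nth_mem[of t xs] nth_mem[of t ys]
      by (auto simp: columns_def simp del: nth_mem)
    then have "U \<in> Sigma_pat 2 n p"
      by (auto simp: U_def Sigma_pat_def patterns_def rect_iff)
    moreover have "map (\<lambda>t. U (0, int t)) [0..<n] = xs" "map (\<lambda>t. U (1, int t)) [0..<n] = ys"
      using xs ys U by (auto intro!: nth_equalityI simp: columns_def)
    moreover have "admissible B (rect 2 n (0, 0)) U"
    proof -
      have "allowed B (U (0, int t)) (U (0, int t + 1)) (U (1, int t)) (U (1, int t + 1))"
        if "Suc t < n" for t
        using that R U[of t] U[of "Suc t"] by (auto simp: col_step_def add.commute)
      then show ?thesis by (auto simp: admissible_iff less_Suc_eq)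
    qed
    ultimately show ?L unfolding psi by metis
  qed
  then show ?thesis
    using psi_minus_less[OF xs] psi_minus_less[OF ys] by (simp add: trans_mat_def)
qed

text \<open>By \<open>psi_bij\<close> every matrix index codes a column, so walks of columns become
  walks in the support of the matrix.\<close>

lemma primitive_trans_mat:
  assumes "T \<ge> 1" and
    mix: "\<And>l xs ys. \<lbrakk>l \<ge> T; xs \<in> columns p n; ys \<in> columns p n\<rbrakk> \<Longrightarrow> (col_step p (allowed B) n ^^ l) xs ys"
  shows "primitive_mat (trans_mat p B n)"
proof -
  let ?A = "trans_mat p B n"
  have dim: "?A \<in> carrier_mat (p ^ n) (p ^ n)" by (simp add: trans_mat_def)
  have nn: "nonneg_mat (p ^ n) ?A" by (auto simp: nonneg_mat_def trans_mat_def)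
  have ex: "\<exists>xs\<in>columns p n. i = psi p xs - 1" if "i < p ^ n" for i
  proof -
    have "Suc i \<in> psi p ` columns p n"
      using that psi_bij[of p n] unfolding bij_betw_def columns_def by auto
    then show ?thesis by force
  qed
  have "(?A ^\<^sub>m l) $$ (i, j) > 0" if "l \<ge> T" and ij: "i < p ^ n" "j < p ^ n" for l i j
  proof -
    obtain xs ys where xy: "xs \<in> columns p n" "ys \<in> columns p n" "i = psi p xs - 1" "j = psi p ys - 1"
      using ex ij by metis
    show ?thesis unfolding pow_mat_pos_iff[OF nn ij] unfolding xy(3,4)
    proof (rule relpowp_map[OF _ mix[OF that(1) xy(1,2)], of _ "\<lambda>xs. psi p xs - 1"])
      fix xs ys assume *: "col_step p (allowed B) n xs ys"
      then have "xs \<in> columns p n" "ys \<in> columns p n" by (auto simp: col_step_def)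
      with * show "psi p xs - 1 < p ^ n \<and> psi p ys - 1 < p ^ n \<and>
        ?A $$ (psi p xs - 1, psi p ys - 1) > 0"
        by (simp add: psi_minus_less trans_mat_entry del: One_nat_def)
    qed
  qed
  then show ?thesis
    using nn dim \<open>T \<ge> 1\<close> by (auto simp: primitive_mat_def nonneg_mat_def)
qed

section \<open>Blocks of the second transition matrix\<close>

text \<open>Since \<open>psi p [i - 1, a] - 1 = (i - 1) * p + a\<close>, the block number is the
  bottom symbol and the place inside the block is the top symbol. Multiplying blocks thus moves an
  upper row along a fixed lower path.\<close>

lemma trans_block_entry:
  assumes "i \<in> {1..p}" "j \<in> {1..p}" "a < p" "c < p"
  shows "trans_block p B 2 i j $$ (a, c) = of_bool (allowed B (i - 1) a (j - 1) c)"
proof -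
  have xy: "[i - 1, a] \<in> columns p 2" "[j - 1, c] \<in> columns p 2"
    using assms by (auto simp: columns_def)
  have "trans_block p B 2 i j $$ (a, c) =
    trans_mat p B 2 $$ (psi p [i - 1, a] - 1, psi p [j - 1, c] - 1)"
    using assms by (simp add: trans_block_def psi_Cons)
  also have "\<dots> = of_bool (col_step p (allowed B) 2 [i - 1, a] [j - 1, c])"
    by (rule trans_mat_entry[OF xy])
  also have "col_step p (allowed B) 2 [i - 1, a] [j - 1, c] \<longleftrightarrow> allowed B (i - 1) a (j - 1) c"
    using xy by (auto simp: col_step_def less_Suc_eq numeral_2_eq_2)
  finally show ?thesis .
qed

text \<open>A non-zero row of a block completes a square on the right, a non-zero column completes
  it on the left.\<close>

lemma non_degenerated_ext:
  assumes "non_degenerated p B" "i < p" "j < p" "a < p"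
  shows "\<exists>c<p. allowed B i a j c" and "\<exists>c<p. allowed B i c j a"
proof -
  let ?A = "trans_block p B 2 (Suc i) (Suc j)"
  have "psi p [i, j] \<in> {1..p ^ 2}" using psi_range[of "[i, j]" p] assms by (simp add: power2_eq_square)
  then have "non_compressible (trans_sub p B 2 (psi p [i, j]))"
    using assms(1) by (auto simp: non_degenerated_def)
  moreover have "trans_sub p B 2 (psi p [i, j]) = ?A"
    using block_index_psi[of "Suc i" p "Suc j"] assms by (simp add: trans_sub_def)
  ultimately have nc: "non_compressible ?A" by simp
  have dim: "dim_row ?A = p" "dim_col ?A = p" by (simp_all add: trans_block_def)
  have ent: "?A $$ (a, c) = of_bool (allowed B i a j c)" if "a < p" "c < p" for a c
    using trans_block_entry[of "Suc i" p "Suc j" a c B] assms that by simp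
  have "row ?A a \<noteq> 0\<^sub>v p" "col ?A a \<noteq> 0\<^sub>v p" using nc assms dim by (auto simp: non_compressible_def)
  then have "\<exists>c<p. ?A $$ (a, c) \<noteq> 0" "\<exists>c<p. ?A $$ (c, a) \<noteq> 0"
    using assms dim by (auto simp: vec_eq_iff)
  then show "\<exists>c<p. allowed B i a j c" "\<exists>c<p. allowed B i c j a"
    using ent assms by (auto split: if_splits simp: of_bool_def)
qed

section \<open>Runs of a row from products of blocks\<close>

text \<open>The intermediate indices of a positive term of the product spell the upper row. The
  start \<open>s\<close> is arbitrary so that the induction can peel off the first factor.\<close>

lemma foldr_mult_row_steps:
  assumes "\<And>l. \<lbrakk>s \<le> l; l < s + d\<rbrakk> \<Longrightarrow> nonneg_mat p (A l)"
    and "\<And>l a c. \<lbrakk>s \<le> l; l < s + d; a < p; c < p; A l $$ (a, c) > 0\<rbrakk> \<Longrightarrow> b (w (int l)) a (w (int l + 1)) c"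
  shows "nonneg_mat p (foldr (\<lambda>l M. A l * M) [s..<s + d] (1\<^sub>m p)) \<and>
    (\<forall>a<p. \<forall>c<p. foldr (\<lambda>l M. A l * M) [s..<s + d] (1\<^sub>m p) $$ (a, c) > 0 \<longrightarrow>
      (row_step p b w ^^ d) (int s, a) (int (s + d), c))"
  using assms
proof (induction d arbitrary: s)
  case 0
  then show ?case by (auto simp: nonneg_mat_one)
next
  case (Suc d)
  define F where "F = foldr (\<lambda>l M. A l * M) [Suc s..<Suc s + d] (1\<^sub>m p)"
  have F: "nonneg_mat p F" "\<And>a c. \<lbrakk>a < p; c < p; F $$ (a, c) > 0\<rbrakk> \<Longrightarrow>
      (row_step p b w ^^ d) (int (Suc s), a) (int (Suc s + d), c)"
    using Suc.IH[of "Suc s"] Suc.prems unfolding F_def by auto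
  have A: "nonneg_mat p (A s)" using Suc.prems(1) by simp
  have eq: "foldr (\<lambda>l M. A l * M) [s..<s + Suc d] (1\<^sub>m p) = A s * F"
    by (simp add: F_def upt_rec[of s] del: upt_Suc)
  have "(row_step p b w ^^ Suc d) (int s, a) (int (s + Suc d), c)"
    if ac: "a < p" "c < p" "(A s * F) $$ (a, c) > 0" for a c
  proof -
    obtain e where e: "e < p" "A s $$ (a, e) > 0" "F $$ (e, c) > 0"
      using mult_mat_pos_iff[OF A F(1) ac(1,2)] ac(3) by blast
    have "row_step p b w (int s, a) (int (Suc s), e)"
      using Suc.prems(2)[of s a e] e ac by (simp add: row_step_def add.commute)
    with F(2)[OF e(1) ac(2) e(3)] show ?thesis
      using relpowp_Suc_I2[of "row_step p b w"] by simp
  qed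
  then show ?case unfolding eq using nonneg_mat_mult[OF A F(1)] by blast
qed

text \<open>Each factor \<open>E\<close> contributes a run over one period; periodicity of
  \<open>w\<close> lets these runs be translated and concatenated.\<close>

lemma pow_mat_row_steps:
  assumes E: "nonneg_mat p E"
    and per: "\<And>x. w (x + int m) = w x"
    and steps: "\<And>a c. \<lbrakk>a < p; c < p; E $$ (a, c) > 0\<rbrakk> \<Longrightarrow> (row_step p b w ^^ m) (0, a) (int m, c)"
    and "a < p" "c < p" "(E ^\<^sub>m N) $$ (a, c) > 0"
  shows "(row_step p b w ^^ (m * N)) (0, a) (int (m * N), c)"
  using assms(5,6)
proof (induction N arbitrary: c)
  case 0
  have "dim_row E = p" using E by (auto simp: nonneg_mat_def)
  with 0 \<open>a < p\<close> show ?case by (auto split: if_splits)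
next
  case (Suc N)
  obtain e where e: "e < p" "(E ^\<^sub>m N) $$ (a, e) > 0" "E $$ (e, c) > 0"
    using mult_mat_pos_iff[OF nonneg_mat_pow[OF E] E \<open>a < p\<close> Suc.prems(1)] Suc.prems(2) by auto
  have w: "w (x + int m * int k) = w x" for x k
  proof (induction k)
    case (Suc k)
    then show ?case using per[of "x + int m * int k"] by (simp add: algebra_simps)
  qed simp
  let ?f = "\<lambda>(x, a::nat). (x + int m * int N, a)"
  have "(row_step p b w ^^ m) (?f (0, e)) (?f (int m, c))"
    by (rule relpowp_map[OF _ steps[OF e(1) Suc.prems(1) e(3)]])
      (auto simp: row_step_def w add.commute add.left_commute)
  then have "(row_step p b w ^^ (m * N + m)) (0, a) (int m + int m * int N, c)"
    using Suc.IH[OF e(1,2)] by (subst relpowp_add) auto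
  then show ?case by (simp add: algebra_simps)
qed

section \<open>The word of a commutative cycle pair\<close>

text \<open>Handles one orientation: \<open>conn\<close> puts \<open>(J I)\<close> on top of
  \<open>(I J)\<close>. Rows are run above the word of the lower path, so \<open>prim\<close>
  concerns \<open>K\<close>.\<close>

lemma trans_mat_primitive_of_stacked_cycles:
  assumes p: "p > 0" and nd: "non_degenerated p B"
    and cyc: "comm_cycle_pair p q q' I J"
    and idx: "pair_index p q q' I J = (m, \<alpha>, K, L)"
    and prim: "primitive_mat (elem_pattern p B m 2 \<alpha> K)"
    and conn: "conn_op p B m \<alpha> \<alpha> $$ (K - 1, L - 1) = 1"
  shows "primitive_mat (trans_mat p B (Suc n))"
proof -
  from cyc have q: "q \<ge> 1" "q' \<ge> 1" and len: "length I = q + 1" "length J = q' + 1"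
    and sub: "set I \<subseteq> {1..p}" "set J \<subseteq> {1..p}"
    and ends: "last I = hd I" "last J = hd I" "hd J = hd I"
    by (auto simp: comm_cycle_pair_def is_cycle_def)
  from idx have m: "m = q + q'" and \<alpha>: "\<alpha> = psi p [hd I - 1, hd I - 1]"
    and K: "K = path_inner p (cycle_prod I J)" and L: "L = path_inner p (cycle_prod J I)"
    by (auto simp: pair_index_def)
  have m2: "m \<ge> 2" using q m by simp
  define js where "js = cycle_prod I J"
  define ks where "ks = cycle_prod J I"
  have ne: "I \<noteq> []" "J \<noteq> []" "tl I \<noteq> []" "tl J \<noteq> []"
    using len q by (auto simp: tl_Nil length_Suc_conv)
  have lens: "length js = m + 1" "length ks = m + 1"
    using len by (auto simp: js_def ks_def cycle_prod_def m)
  have subs: "set js \<subseteq> {1..p}" "set ks \<subseteq> {1..p}"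
    using sub ne by (auto simp: js_def ks_def cycle_prod_def dest!: list.set_sel(2))
  have js_ends: "hd js = hd I" "last js = hd I" "hd ks = hd I" "last ks = hd I"
    using ne ends by (auto simp: js_def ks_def cycle_prod_def last_tl)
  have js_in: "js ! k \<in> {1..p}" "ks ! k \<in> {1..p}" if "k \<le> m" for k
    using that subs lens nth_mem[of k js] nth_mem[of k ks] by (auto simp del: nth_mem)
  \<comment> \<open>Cycle entries start at 1 and symbols at 0, hence the subtraction. The last of
    the \<open>m + 1\<close> entries of \<open>js\<close> repeats the first, so reading modulo
    \<open>m\<close> loses nothing.\<close>
  define w where "w x = js ! nat (x mod int m) - 1" for x
  have w_per: "w (x + int m) = w x" for x by (simp add: w_def)
  have nth_ends: "xs ! 0 = hd I" "xs ! m = hd I"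
    if "length xs = m + 1" "hd xs = hd I" "last xs = hd I" for xs
  proof -
    have "xs \<noteq> []" using that(1) by auto
    then show "xs ! 0 = hd I" "xs ! m = hd I"
      using that hd_conv_nth[of xs] last_conv_nth[of xs] by simp_all
  qed
  note js0 = nth_ends[OF lens(1) js_ends(1,2)]
  have w_js: "w (int k) = js ! k - 1" if "k \<le> m" for k
    using that js0 m2 by (cases "k = m") (auto simp: w_def)
  \<comment> \<open>\<open>(J I)\<close> is the rotation of \<open>(I J)\<close> by
    \<open>q\<close>: from position \<open>q\<close> on, \<open>w\<close> spells \<open>J\<close> up
    to index \<open>q'\<close> and then wraps around into \<open>I\<close>. At \<open>k = 0\<close>
    the closing entry of \<open>I\<close> plays the part of the first entry of
    \<open>J\<close>.\<close>
  have w_ks: "w (int k + int q) = ks ! k - 1" if k: "k \<le> m" for k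
  proof (cases "k \<le> q'")
    case True
    have "w (int k + int q) = js ! (k + q) - 1" using w_js[of "k + q"] True m by simp
    also have "js ! (k + q) = J ! k"
    proof (cases k)
      case 0
      have "I ! q = last I" "J ! 0 = hd J" using len ne by (simp_all add: last_conv_nth hd_conv_nth)
      then show ?thesis using 0 len ends by (simp add: js_def cycle_prod_def nth_append)
    next
      case (Suc k')
      then show ?thesis using len True by (simp add: js_def cycle_prod_def nth_append nth_tl)
    qed
    also have "J ! k = ks ! k" using True len by (simp add: ks_def cycle_prod_def nth_append)
    finally show ?thesis .
  next
    case False
    have "w (int k + int q) = w (int (k - q'))" using w_per[of "int (k - q')"] False m by simp
    also have "\<dots> = js ! (k - q') - 1" using k m by (intro w_js) simp
    also have "js ! (k - q') = ks ! k" using False k m len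
      by (auto simp: js_def ks_def cycle_prod_def nth_append nth_tl Suc_diff_Suc)
    finally show ?thesis .
  qed
  have inner: "map (\<lambda>j. j - 1) (butlast (tl xs)) ! (k - 1) = xs ! k - 1"
    if "length xs = m + 1" "1 \<le> k" "k < m" for xs :: "nat list" and k
    using that by (cases k) (simp_all add: nth_butlast nth_tl)
  have inner_columns: "map (\<lambda>j. j - 1) (butlast (tl xs)) \<in> columns p (m - 1)"
    if "length xs = m + 1" "set xs \<subseteq> {1..p}" for xs :: "nat list"
  proof -
    have "set (butlast (tl xs)) \<subseteq> {1..p}"
      using that by (cases xs) (auto dest!: in_set_butlastD)
    then show ?thesis using that p by (force simp: columns_def)
  qed

  \<comment> \<open>The pattern behind the entry 1 of the connecting operator has bottom row
    \<open>js\<close> and top row \<open>ks\<close>, that is, \<open>w\<close> below and its shift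
    by \<open>q\<close> above.\<close>
  have stack: "allowed B (w x) (w (x + int q)) (w (x + 1)) (w (x + 1 + int q))" for x
  proof -
    have KL: "K - 1 < p ^ (m - 1)" "L - 1 < p ^ (m - 1)"
      and KL1: "K - 1 + 1 = K" "L - 1 + 1 = L"
      using psi_minus_less[OF inner_columns[OF lens(1) subs(1)]]
        psi_minus_less[OF inner_columns[OF lens(2) subs(2)]]
      by (auto simp: K L path_inner_def js_def ks_def psi_def)
    from conn have "\<exists>U \<in> Sigma_pat (m + 1) 2 p.
        \<alpha> = psi p [U (0, 0), U (int m, 0)] \<and>
        \<alpha> = psi p [U (0, 1), U (int m, 1)] \<and>
        K - 1 + 1 = psi p (map (\<lambda>a. U (int a, 0)) [1..<m]) \<and>
        L - 1 + 1 = psi p (map (\<lambda>a. U (int a, 1)) [1..<m]) \<and>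
        admissible B (rect (m + 1) 2 (0, 0)) U"
      unfolding conn_op_def using KL by (simp del: One_nat_def split: if_splits)
    then obtain U where U: "U \<in> Sigma_pat (m + 1) 2 p"
        "\<alpha> = psi p [U (0, 0), U (int m, 0)]"
        "\<alpha> = psi p [U (0, 1), U (int m, 1)]"
        "K = psi p (map (\<lambda>a. U (int a, 0)) [1..<m])"
        "L = psi p (map (\<lambda>a. U (int a, 1)) [1..<m])"
        "admissible B (rect (m + 1) 2 (0, 0)) U" unfolding KL1 by blast
    have Ul: "U (int a, 0) < p" "U (int a, 1) < p" if "a \<le> m" for a
      using U(1) that by (auto simp: Sigma_pat_def patterns_def rect_iff PiE_iff)
    \<comment> \<open>\<open>\<alpha>\<close> fixes the first and last symbol of a row, the inner
      index all the others.\<close>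
    have row: "U (int k, y) = xs ! k - 1"
      if xs: "length xs = m + 1" "set xs \<subseteq> {1..p}" "hd xs = hd I" "last xs = hd I"
        and Ul: "\<And>a. a \<le> m \<Longrightarrow> U (int a, y) < p"
        and e: "\<alpha> = psi p [U (0, y), U (int m, y)]"
        and i: "path_inner p xs = psi p (map (\<lambda>a. U (int a, y)) [1..<m])" and k: "k \<le> m"
      for xs y k
    proof -
      have "hd I \<in> {1..p}" using sub ne by (auto dest!: list.set_sel(1))
      then have "[U (0, y), U (int m, y)] = [hd I - 1, hd I - 1]"
        using e \<alpha> Ul[of 0] Ul[of m] by (intro psi_inj[of _ _ p]) auto
      moreover have "map (\<lambda>j. j - 1) (butlast (tl xs)) = map (\<lambda>a. U (int a, y)) [1..<m]"
        using i inner_columns[OF xs(1,2)] Ul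
        by (intro psi_inj[of _ _ p]) (auto simp: path_inner_def columns_def)
      then have "U (int k, y) = xs ! k - 1" if "1 \<le> k" "k < m"
        using inner[OF xs(1) that] that by simp
      moreover have "xs ! 0 = hd I" "xs ! m = hd I" by (rule nth_ends[OF xs(1,3,4)])+
      ultimately show ?thesis using k by (cases "k = 0"; cases "k = m") auto
    qed
    have U0: "U (int k, 0) = w (int k)" if "k \<le> m" for k
      unfolding w_js[OF that]
      by (rule row[OF lens(1) subs(1) js_ends(1,2) _ U(2) U(4)[unfolded K, folded js_def] that])
        (rule Ul)
    have U1: "U (int k, 1) = w (int k + int q)" if "k \<le> m" for k
      unfolding w_ks[OF that]
      by (rule row[OF lens(2) subs(2) js_ends(3,4) _ U(3) U(5)[unfolded L, folded ks_def] that])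
        (rule Ul)
    \<comment> \<open>The \<open>m + 1\<close> columns of \<open>U\<close> contain all
      \<open>m\<close> squares of a period, so the square at \<open>x\<close> is found at
      \<open>x\<close> modulo \<open>m\<close>.\<close>
    define k where "k = nat (x mod int m)"
    have k: "k < m" "int k = x mod int m"
      using m2 by (auto simp: k_def nat_less_iff)
    have wk: "w (x + y) = w (int k + y)" for y
      by (simp add: w_def k mod_simps)
    have "allowed B (U (int k, 0)) (U (int k, 1)) (U (int (Suc k), 0)) (U (int (Suc k), 1))"
      using U(6)[unfolded admissible_iff, rule_format, of k 0] k by (simp add: add.commute)
    then have "allowed B (w (int k + 0)) (w (int k + int q)) (w (int k + 1)) (w (int k + (1 + int q)))"
      using U0[of k] U0[of "Suc k"] U1[of k] U1[of "Suc k"] k by (simp add: add_ac)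
    then show ?thesis unfolding wk[symmetric] by (simp add: add_ac)
  qed

  \<comment> \<open>The factors of \<open>E\<close> are the blocks at consecutive letters of
    \<open>w\<close>, so a positive entry of \<open>E\<close> is a run over one period.\<close>
  define E where "E = elem_pattern p B m 2 \<alpha> K"
  have "path_of p m \<alpha> K = js"
    using path_of_eq[OF lens(1) subs(1)] m2 by (simp add: \<alpha> K path_ends_def js_ends flip: js_def)
  then have E_eq: "E = foldr (\<lambda>l M. trans_block p B 2 (js ! l) (js ! (l + 1)) * M) [0..<0 + m] (1\<^sub>m p)"
    by (simp add: E_def elem_pattern_def)
  have ent: "trans_block p B 2 (js ! l) (js ! (l + 1)) $$ (a, c) =
      of_bool (allowed B (w (int l)) a (w (int l + 1)) c)" if "l < m" "a < p" "c < p" for l a c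
    using trans_block_entry[OF js_in(1)[of l] js_in(1)[of "l + 1"]] w_js[of l] w_js[of "l + 1"] that
    by (simp add: add.commute)
  have bl: "nonneg_mat p (trans_block p B 2 (js ! l) (js ! (l + 1)))" if "l < m" for l
    using ent[OF that] by (auto simp: nonneg_mat_def trans_block_def)
  have E: "nonneg_mat p E"
    "\<And>a c. \<lbrakk>a < p; c < p; E $$ (a, c) > 0\<rbrakk> \<Longrightarrow> (row_step p (allowed B) w ^^ m) (0, a) (int m, c)"
    using foldr_mult_row_steps[where s = 0 and d = m and p = p and b = "allowed B" and w = w
        and A = "\<lambda>l. trans_block p B 2 (js ! l) (js ! (l + 1))"] bl ent
    unfolding E_eq by (auto split: if_splits simp: of_bool_def)
  from E(1) have "dim_row E = p" "dim_col E = p" by (auto simp: nonneg_mat_def)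
  with prim obtain N where N: "\<And>a c. \<lbrakk>a < p; c < p\<rbrakk> \<Longrightarrow> (E ^\<^sub>m N) $$ (a, c) > 0"
    unfolding E_def[symmetric] primitive_mat_def by (metis order_refl)
  \<comment> \<open>\<open>N\<close> is an exponent for which the power of \<open>E\<close> is
    positive; each factor covers \<open>m\<close> positions, whence \<open>m * N\<close>.\<close>
  interpret staircase p "allowed B" w "int q" m "m * N"
  proof
    show "w x < p" for x
    proof -
      have "nat (x mod int m) \<le> m" using m2 by (simp add: nat_le_iff less_imp_le)
      then show ?thesis using js_in(1)[of "nat (x mod int m)"] by (auto simp: w_def)
    qed
    show "(row_step p (allowed B) w ^^ (m * N)) (0, a) (int (m * N), c)" if "a < p" "c < p" for a c
      using pow_mat_row_steps[OF E(1) w_per E(2) that N[OF that]] by blast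
  qed (use m2 w_per stack non_degenerated_ext[OF nd] in auto)
  from col_step_mixing[of n] show ?thesis
    using primitive_trans_mat[of _ p "Suc n" B] by blast
qed

theorem theorem4p8:
  fixes p :: nat and B :: "(int \<times> int \<Rightarrow> nat) set"
  assumes "p \<ge> 2"
    and "B \<subseteq> Sigma_pat 2 2 p"
    and "non_degenerated p B"
    and "\<exists>q q' I J m \<alpha> K L.
           H_primitive_pair p B q q' I J \<and>
           pair_index p q q' I J = (m, \<alpha>, K, L) \<and>
           (conn_op p B m \<alpha> \<alpha> $$ (K - 1, L - 1) = 1 \<or>
            conn_op p B m \<alpha> \<alpha> $$ (L - 1, K - 1) = 1)"
  shows "\<forall>n\<ge>2. primitive_mat (trans_mat p B n)"
proof (intro allI impI)
  fix n :: nat assume "n \<ge> 2"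
  then obtain n' where n: "n = Suc n'" by (cases n) auto
  obtain q q' I J m \<alpha> K L where
    H: "H_primitive_pair p B q q' I J" and idx: "pair_index p q q' I J = (m, \<alpha>, K, L)"
    and conn: "conn_op p B m \<alpha> \<alpha> $$ (K - 1, L - 1) = 1 \<or>
      conn_op p B m \<alpha> \<alpha> $$ (L - 1, K - 1) = 1"
    using assms(4) by blast
  from H idx have cyc: "comm_cycle_pair p q q' I J"
    and prim: "primitive_mat (elem_pattern p B m 2 \<alpha> K)" "primitive_mat (elem_pattern p B m 2 \<alpha> L)"
    by (auto simp: H_primitive_pair_def)
  \<comment> \<open>Exchanging the two cycles exchanges \<open>K\<close> and \<open>L\<close> and
    keeps \<open>m\<close> and \<open>\<alpha>\<close>, so the second alternative of
    \<open>conn\<close> is an instance of the first.\<close>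
  have swap: "comm_cycle_pair p q' q J I" "pair_index p q' q J I = (m, \<alpha>, L, K)"
    using cyc idx by (auto simp: comm_cycle_pair_def pair_index_def)
  have p: "p > 0" using assms(1) by simp
  from conn show "primitive_mat (trans_mat p B n)"
    unfolding n
    using trans_mat_primitive_of_stacked_cycles[OF p assms(3) cyc idx prim(1)]
      trans_mat_primitive_of_stacked_cycles[OF p assms(3) swap prim(2)] by blast
qed

end
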